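(* Suppose there exists a strongly regular graph with parameters $(v,k,\lambda,\mu)$ satisfying $\mu=\lambda+1$. Then there exist STD$(v)$ self-dual rectangular designs with the following parameters (listed as number of treatments, block size, $\lambda_1,\lambda_2,\lambda_3$, $m$, $n$): (i) $v_1=2v$, $k_1=v-1$, $\lambda_1=v-2k+2$, $\lambda_2=0$, $\lambda_3=2(k-\lambda-1)$, $m=2$, $n=v$; (ii) $v_1=2v$, $k_1=v+1$, $\lambda_1=v-2(k-\lambda)+2$, $\lambda_2=2$, $\lambda_3=2(k-\lambda)$, $m=2$, $n=v$; (iii) $v_1=3v$, $k_1=v$, $\lambda_1=v-2(k-\lambda)$, $\lambda_2=0$, $\lambda_3=k-\lambda$, $m=3$, $n=v$.
   Context: A strongly regular graph with parameters $(v,k,\lambda,\mu)$ is a simple graph on $v$ vertices, regular of degree $k$ with $0<k<v-1$, in which any two adjacent vertices have exactly $\lambda$ common neighbours and any two distinct non-adjacent vertices have exactly $\mu$ common neighbours. A rectangular design (RD) on $mn$ treatments arranged in an $m\times n$ array has blocks of a fixed size, constant replication, and any two distinct treatments occur together in $\lambda_1$ blocks if in the same row, $\lambda_2$ if in the same column, $\lambda_3$ otherwise. It is self-dual (SDRD) if the number of blocks equals the number of treatments and the design with transposed incidence matrix is an RD with the same parameters; it is STD$(n)$ if its incidence matrix (rows grouped by rows of the array) is partitioned into $n\times n$ submatrices each with constant row sums and constant column sums.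
   Formalization: In part (i), λ₁ = v−2k+2 is corrected to λ₁ = v−2k+2λ; the printed value is impossible unless λ = 1 (for the pentagon (5,2,0,1), counting pairs forces λ₁ = 1, not 3), and the two values agree when λ = 1. *)

theory Defs
  imports "Jordan_Normal_Form.Matrix" "Graph_Theory.Pair_Digraph"
begin

text \<open>\<open>pair_graph G\<close> says that \<open>G\<close> is a finite simple graph; each edge is represented by its
two orientations.\<close>

definition strongly_regular_graph ::
  "'a pair_pre_digraph \<Rightarrow> nat \<Rightarrow> nat \<Rightarrow> nat \<Rightarrow> nat \<Rightarrow> bool" where
  "strongly_regular_graph G v k l \<mu> \<longleftrightarrow>
     pair_graph G \<and> card (pverts G) = v \<and> 0 < k \<and> k + 1 < v \<and>
     (\<forall>x \<in> pverts G. card {z. (x, z) \<in> parcs G} = k) \<and>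
     (\<forall>x \<in> pverts G. \<forall>y \<in> pverts G. (x, y) \<in> parcs G \<longrightarrow>
        card {z. (x, z) \<in> parcs G \<and> (y, z) \<in> parcs G} = l) \<and>
     (\<forall>x \<in> pverts G. \<forall>y \<in> pverts G. x \<noteq> y \<and> (x, y) \<notin> parcs G \<longrightarrow>
        card {z. (x, z) \<in> parcs G \<and> (y, z) \<in> parcs G} = \<mu>)"

text \<open>A design is given by its incidence matrix: rows are indexed by treatments, columns by
blocks, and repeated blocks are allowed.\<close>

definition concurrence :: "nat mat \<Rightarrow> nat \<Rightarrow> nat \<Rightarrow> nat" where
  "concurrence N s t = card {j. j < dim_col N \<and> N $$ (s, j) = 1 \<and> N $$ (t, j) = 1}"

text \<open>The rows of \<open>N\<close> are grouped by rows of the \<open>m \<times> n\<close> array, i.e. treatment \<open>t\<close>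
is in row \<open>t div n\<close> and column \<open>t mod n\<close> of the array. The concurrence parameters are
integers so that differences of parameters can be written without truncation.\<close>

definition rectangular_design ::
  "nat \<Rightarrow> nat \<Rightarrow> nat \<Rightarrow> int \<Rightarrow> int \<Rightarrow> int \<Rightarrow> nat \<Rightarrow> nat \<Rightarrow> nat mat \<Rightarrow> bool" where
  "rectangular_design v r k l1 l2 l3 m n N \<longleftrightarrow>
     v = m * n \<and> dim_row N = v \<and> elements_mat N \<subseteq> {0, 1} \<and>
     (\<forall>j < dim_col N. card {t. t < v \<and> N $$ (t, j) = 1} = k) \<and>
     (\<forall>t < v. card {j. j < dim_col N \<and> N $$ (t, j) = 1} = r) \<and>
     (\<forall>s < v. \<forall>t < v. s \<noteq> t \<longrightarrow>
        int (concurrence N s t) =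
          (if s div n = t div n then l1 else if s mod n = t mod n then l2 else l3))"

text \<open>The columns of the incidence matrix are ordered so that they are grouped by rows of the
array in which the treatments of the dual design are arranged.\<close>

definition self_dual_rectangular_design ::
  "nat \<Rightarrow> nat \<Rightarrow> int \<Rightarrow> int \<Rightarrow> int \<Rightarrow> nat \<Rightarrow> nat \<Rightarrow> nat mat \<Rightarrow> bool" where
  "self_dual_rectangular_design v k l1 l2 l3 m n N \<longleftrightarrow>
     dim_col N = v \<and>
     (\<exists>r. rectangular_design v r k l1 l2 l3 m n N \<and>
          rectangular_design v r k l1 l2 l3 m n (transpose_mat N))"

text \<open>The constant row and column sums may differ from one \<open>n \<times> n\<close> submatrix to another.\<close>

definition STD :: "nat \<Rightarrow> nat mat \<Rightarrow> bool" where
  "STD n N \<longleftrightarrow>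
     0 < n \<and> n dvd dim_row N \<and> n dvd dim_col N \<and>
     (\<forall>I < dim_row N div n. \<forall>J < dim_col N div n.
        (\<exists>\<rho>. \<forall>a < n. (\<Sum>b < n. N $$ (I * n + a, J * n + b)) = \<rho>) \<and>
        (\<exists>\<kappa>. \<forall>b < n. (\<Sum>a < n. N $$ (I * n + a, J * n + b)) = \<kappa>))"

text \<open>The parameters of a rectangular design satisfy the following relation, so the block size,
the replication number and two of the concurrence parameters determine the third. In particular,
a self-dual design on a \<open>2 \<times> v\<close> array with block size \<open>v - 1\<close>, \<open>l2 = 0\<close> and
\<open>l3 = 2 * (k - l - 1)\<close> has \<open>l1 = v - 2 * k + 2 * l\<close>; the source prints this value as
\<open>v - 2 * k + 2\<close>, which is possible only for \<open>l = 1\<close>.\<close>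

lemma rectangular_design_parameter_relation:
  assumes rd: "rectangular_design v r k l1 l2 l3 m n N" and m: "0 < m" and n: "0 < n"
  shows "int r * (int k - 1) =
    l1 * (int n - 1) + l2 * (int m - 1) + l3 * ((int m - 1) * (int n - 1))"
proof -
  have v: "v = m * n"
    and blk: "\<And>j. j < dim_col N \<Longrightarrow> card {t. t < v \<and> N $$ (t, j) = 1} = k"
    and rep: "\<And>t. t < v \<Longrightarrow> card {j. j < dim_col N \<and> N $$ (t, j) = 1} = r"
    and con: "\<And>s t. s < v \<Longrightarrow> t < v \<Longrightarrow> s \<noteq> t \<Longrightarrow> int (concurrence N s t) =
          (if s div n = t div n then l1 else if s mod n = t mod n then l2 else l3)"
    using rd unfolding rectangular_design_def by auto
  have v0: "0 < v" using v m n by simp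
  define B where "B = {j. j < dim_col N \<and> N $$ (0, j) = 1}"
  have finB: "finite B" by (simp add: B_def)
  have cc: "concurrence N 0 t = card {j \<in> B. N $$ (t, j) = 1}" for t
    unfolding concurrence_def B_def by (rule arg_cong[where f = card]) auto
  have c0: "concurrence N 0 0 = r"
    using rep[OF v0] by (simp add: concurrence_def)
  have "(\<Sum>t<v. concurrence N 0 t) = (\<Sum>t<v. \<Sum>j\<in>B. if N $$ (t, j) = 1 then 1 else 0)"
    using finB by (simp add: cc sum.If_cases Int_def)
  also have "\<dots> = (\<Sum>j\<in>B. \<Sum>t<v. if N $$ (t, j) = 1 then 1 else 0)"
    by (rule sum.swap)
  also have "\<dots> = (\<Sum>j\<in>B. k)"
    by (rule sum.cong) (auto simp: sum.If_cases Int_def B_def blk[simplified])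
  also have "\<dots> = r * k" using rep[OF v0] by (simp add: B_def)
  finally have tot: "(\<Sum>t<v. int (concurrence N 0 t)) = int r * int k"
    by (simp flip: of_nat_sum of_nat_mult)
  let ?f = "\<lambda>i a. if i = 0 \<and> a = 0 then int r else if i = 0 then l1
                   else if a = (0::nat) then l2 else l3"
  have "(\<Sum>t<v. int (concurrence N 0 t)) = (\<Sum>t<m*n. ?f (t div n) (t mod n))"
    unfolding v
  proof (rule sum.cong)
    fix t assume t: "t \<in> {..<m * n}"
    show "int (concurrence N 0 t) = ?f (t div n) (t mod n)"
    proof (cases "t = 0")
      case True then show ?thesis by (simp add: c0)
    next
      case False
      then have "\<not> (t div n = 0 \<and> t mod n = 0)"
        by (metis div_mod_decomp mult_0 add_0)
      then show ?thesis using con[OF v0, of t] t False v by auto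
    qed
  qed simp
  also have "\<dots> = (\<Sum>i<m. \<Sum>a<n. ?f i a)"
  proof -
    have "(\<Sum>i<m. \<Sum>t\<in>{i * n..<i * n + n}. ?f (t div n) (t mod n)) =
          (\<Sum>t<m*n. ?f (t div n) (t mod n))"
      by (rule sum.nat_group)
    moreover have "(\<Sum>t\<in>{i * n..<i * n + n}. ?f (t div n) (t mod n)) = (\<Sum>a<n. ?f i a)" for i
      by (subst sum.atLeastLessThan_shift_0) (auto simp: lessThan_atLeast0 intro!: sum.cong)
    ultimately show ?thesis by simp
  qed
  also have "\<dots> = int r + l1 * (int n - 1) + l2 * (int m - 1) + l3 * ((int m - 1) * (int n - 1))"
  proof -
    obtain p where p: "n = Suc p" using n by (cases n) auto
    obtain q where q: "m = Suc q" using m by (cases m) auto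
    show ?thesis unfolding p q sum.lessThan_Suc_shift by (simp add: algebra_simps)
  qed
  finally show ?thesis using tot by (simp add: algebra_simps)
qed

end

theory Submission
  imports Defs
begin

text \<open>Let \<open>A\<close> be the adjacency matrix and \<open>B = J - I - A\<close> that of the complement. If
\<open>\<mu> = \<lambda> + 1\<close>, then \<open>A\<^sup>2 = (k - \<lambda> - 1) I - A + (\<lambda> + 1) J\<close>, so
\<open>A B = (k - \<lambda> - 1) (J - I)\<close> and \<open>A\<^sup>2 + B\<^sup>2 = (v - 2 k + 2 \<lambda>) J + (2 k - 2 \<lambda> - 1) I\<close>.
Hence the symmetric block matrices with block rows \<open>(A, B), (B, A)\<close>, respectively
\<open>(A + I, B + I), (B + I, A + I)\<close> and \<open>(A, B, I), (B, I, A), (I, A, B)\<close>, are incidence matrices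
of the three designs.\<close>

section \<open>Designs from symmetric arrays of square blocks\<close>

lemma sum_div_mod:
  "(\<Sum>j<m * n. g (j div n) (j mod n)) = (\<Sum>i<m. \<Sum>z<n. g i z)" for n :: nat
proof -
  have "(\<Sum>j\<in>{i * n..<i * n + n}. g (j div n) (j mod n)) = (\<Sum>z<n. g i z)" for i
    by (subst sum.atLeastLessThan_shift_0) (auto simp: lessThan_atLeast0 intro!: sum.cong)
  then show ?thesis
    by (simp flip: sum.nat_group)
qed

lemma int_card_div_mod:
  "int (card {j. j < m * n \<and> P (j div n) (j mod n)}) = (\<Sum>i<m. \<Sum>z<n. of_bool (P i z))" for n :: nat
proof -
  have "int (card {j. j < m * n \<and> P (j div n) (j mod n)}) =
      (\<Sum>j<m * n. of_bool (P (j div n) (j mod n)))"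
    by (simp add: Int_def)
  then show ?thesis
    by (simp add: sum_div_mod[where g = "\<lambda>i z. of_bool (P i z)"])
qed

text \<open>Here \<open>M I J a b\<close> is entry \<open>(a, b)\<close> of block
  \<open>(I, J)\<close>. By \<open>sym\<close> the assembled matrix equals its transpose, so
  self-duality and every condition on columns follow from the row conditions, and the replication
  number is also \<open>k\<close>. What remains are identities between sums of products of
  blocks.\<close>

lemma symmetric_block_design:
  fixes M :: "nat \<Rightarrow> nat \<Rightarrow> nat \<Rightarrow> nat \<Rightarrow> bool" and R :: "nat \<Rightarrow> nat \<Rightarrow> int"
  assumes n: "0 < n"
    and sym: "\<And>I J a b. M I J a b = M J I b a"
    and row: "\<And>I J a. I < m \<Longrightarrow> J < m \<Longrightarrow> a < n \<Longrightarrow> (\<Sum>z<n. of_bool (M I J a z)) = R I J"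
    and size: "\<And>I. I < m \<Longrightarrow> (\<Sum>J<m. R I J) = int k"
    and conc: "\<And>I I' a b. I < m \<Longrightarrow> I' < m \<Longrightarrow> a < n \<Longrightarrow> b < n \<Longrightarrow> \<not> (I = I' \<and> a = b) \<Longrightarrow>
      (\<Sum>J<m. \<Sum>z<n. of_bool (M I J a z) * of_bool (M I' J b z)) =
        (if I = I' then l1 else if a = b then l2 else l3)"
  shows "\<exists>N. STD n N \<and> self_dual_rectangular_design (m * n) k l1 l2 l3 m n N"
proof -
  define N :: "nat mat" where
    "N = mat (m * n) (m * n) (\<lambda>(s, t). of_bool (M (s div n) (t div n) (s mod n) (t mod n)))"
  have dim: "dim_row N = m * n" "dim_col N = m * n"
    by (simp_all add: N_def)
  have N: "N $$ (s, t) = of_bool (M (s div n) (t div n) (s mod n) (t mod n))"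
    if "s < m * n" "t < m * n" for s t
    using that by (simp add: N_def)
  have N1: "N $$ (s, t) = 1 \<longleftrightarrow> M (s div n) (t div n) (s mod n) (t mod n)"
    if "s < m * n" "t < m * n" for s t
    using that by (simp add: N of_bool_def)
  have tr: "transpose_mat N = N"
    using sym by (intro eq_matI) (auto simp: dim N)
  have div: "s div n < m" if "s < m * n" for s
    using that by (simp add: less_mult_imp_div_less)
  have rep: "card {j. j < m * n \<and> N $$ (t, j) = 1} = k" if t: "t < m * n" for t
  proof -
    have "{j. j < m * n \<and> N $$ (t, j) = 1} =
        {j. j < m * n \<and> M (t div n) (j div n) (t mod n) (j mod n)}"
      using t by (auto simp del: One_nat_def simp: N1)
    then have "int (card {j. j < m * n \<and> N $$ (t, j) = 1}) = (\<Sum>J<m. R (t div n) J)"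
      using n div[OF t] int_card_div_mod[of m n "\<lambda>J. M (t div n) J (t mod n)"]
      by (simp add: row del: sum_of_bool_eq)
    then show ?thesis
      using size[OF div[OF t]] by simp
  qed
  have blk: "card {t. t < m * n \<and> N $$ (t, j) = 1} = k" if j: "j < m * n" for j
  proof -
    have "N $$ (t, j) = N $$ (j, t)" if "t < m * n" for t
      using j that sym by (simp add: N)
    then have "{t. t < m * n \<and> N $$ (t, j) = 1} = {t. t < m * n \<and> N $$ (j, t) = 1}"
      by auto
    then show ?thesis
      using rep[OF j] by simp
  qed
  have con: "int (concurrence N s t) =
      (if s div n = t div n then l1 else if s mod n = t mod n then l2 else l3)"
    if s: "s < m * n" and t: "t < m * n" and st: "s \<noteq> t" for s t
  proof -
    have "{j. j < m * n \<and> N $$ (s, j) = 1 \<and> N $$ (t, j) = 1} = {j. j < m * n \<and>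
        (M (s div n) (j div n) (s mod n) (j mod n) \<and> M (t div n) (j div n) (t mod n) (j mod n))}"
      using s t by (auto simp del: One_nat_def simp: N1)
    then have "int (concurrence N s t) = (\<Sum>J<m. \<Sum>z<n.
        of_bool (M (s div n) J (s mod n) z) * of_bool (M (t div n) J (t mod n) z))"
      using int_card_div_mod[of m n
          "\<lambda>J z. M (s div n) J (s mod n) z \<and> M (t div n) J (t mod n) z"]
      unfolding concurrence_def dim of_bool_conj by simp
    moreover have "\<not> (s div n = t div n \<and> s mod n = t mod n)"
      using st by (metis div_mod_decomp)
    ultimately show ?thesis
      using conc[OF div[OF s] div[OF t], of "s mod n" "t mod n"] n by simp
  qed
  have "elements_mat N \<subseteq> {0, 1}"
    by (auto simp: elements_mat_def N dim)
  then have rd: "rectangular_design (m * n) k k l1 l2 l3 m n N"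
    unfolding rectangular_design_def dim using rep blk con by simp
  have "STD n N"
    unfolding STD_def
  proof (intro conjI allI impI)
    fix I J
    assume "I < dim_row N div n" "J < dim_col N div n"
    then have IJ: "I < m" "J < m"
      using n by (simp_all add: dim)
    have lt: "K * n + c < m * n" if "K < m" "c < n" for K c
    proof -
      have "K * n + c < Suc K * n"
        using that by simp
      also have "\<dots> \<le> m * n"
        using that by (intro mult_le_mono1) simp
      finally show ?thesis .
    qed
    have ent: "N $$ (I * n + a, J * n + b) = of_bool (M I J a b)" if "a < n" "b < n" for a b
      using that IJ by (simp add: N lt)
    \<comment> \<open>The incidence matrix has natural entries, whereas \<open>row\<close> is an
      integer statement.\<close>
    have int_of_bool_sum: "(\<Sum>z<n. of_bool (Q z)) = nat (\<Sum>z<n. of_bool (Q z) :: int)" for Q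
      by simp
    have "(\<Sum>b<n. N $$ (I * n + a, J * n + b)) = nat (R I J)" if "a < n" for a
      using row[OF IJ that] that by (simp add: ent int_of_bool_sum)
    \<comment> \<open>By \<open>sym\<close>, column \<open>b\<close> of block \<open>(I, J)\<close>
      is row \<open>b\<close> of block \<open>(J, I)\<close>.\<close>
    moreover have "(\<Sum>a<n. N $$ (I * n + a, J * n + b)) = nat (R J I)" if "b < n" for b
      using row[OF IJ(2,1) that] that by (simp add: ent int_of_bool_sum sym[of I J])
    ultimately show
      "\<exists>\<rho>. \<forall>a<n. (\<Sum>b<n. N $$ (I * n + a, J * n + b)) = \<rho>"
      "\<exists>\<kappa>. \<forall>b<n. (\<Sum>a<n. N $$ (I * n + a, J * n + b)) = \<kappa>"
      by blast+
  qed (use n in \<open>simp_all add: dim\<close>)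
  then show ?thesis
    using rd unfolding self_dual_rectangular_design_def by (intro exI[of _ N]) (auto simp: dim tr)
qed

section \<open>The adjacency matrix of the graph\<close>

text \<open>Numbering the vertices by a bijection from \<open>{..<v}\<close> turns degrees into row
  sums and common neighbour counts into entries of the squared adjacency matrix.\<close>

lemma strongly_regular_graph_on_nat:
  assumes "strongly_regular_graph G v k l \<mu>"
  obtains E :: "nat \<Rightarrow> nat \<Rightarrow> bool" where
    "\<And>a b. E a b = E b a" "\<And>a. \<not> E a a"
    "\<And>a. a < v \<Longrightarrow> (\<Sum>z<v. of_bool (E a z)) = int k"
    "\<And>a b. a < v \<Longrightarrow> b < v \<Longrightarrow> (\<Sum>z<v. of_bool (E a z) * of_bool (E b z)) =
      (if a = b then int k else if E a b then int l else int \<mu>)"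
proof -
  from assms have G: "pair_graph G" and card: "card (pverts G) = v"
    and deg: "\<And>x. x \<in> pverts G \<Longrightarrow> card {z. (x, z) \<in> parcs G} = k"
    and adj: "\<And>x y. x \<in> pverts G \<Longrightarrow> y \<in> pverts G \<Longrightarrow> (x, y) \<in> parcs G \<Longrightarrow>
        card {z. (x, z) \<in> parcs G \<and> (y, z) \<in> parcs G} = l"
    and nadj: "\<And>x y. x \<in> pverts G \<Longrightarrow> y \<in> pverts G \<Longrightarrow> x \<noteq> y \<Longrightarrow> (x, y) \<notin> parcs G \<Longrightarrow>
        card {z. (x, z) \<in> parcs G \<and> (y, z) \<in> parcs G} = \<mu>"
    unfolding strongly_regular_graph_def by auto
  interpret pair_graph G by (fact G)
  obtain f where f: "bij_betw f {..<v} (pverts G)"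
    using ex_bij_betw_nat_finite[of "pverts G"] card by (auto simp: lessThan_atLeast0)
  define E where "E a b \<longleftrightarrow> (f a, f b) \<in> parcs G" for a b
  have f_in: "f a \<in> pverts G" if "a < v" for a
    using f that by (auto simp: bij_betw_def)
  \<comment> \<open>The side condition ensures that the numbering reaches everything counted; it
    holds below because arcs end at vertices.\<close>
  have tr: "(\<Sum>z<v. of_bool (P (f z))) = int (card {z. P z})"
    if "\<And>z. P z \<Longrightarrow> z \<in> pverts G" for P
  proof -
    have "{z. P z} = f ` {z \<in> {..<v}. P (f z)}"
      using f that by (fastforce simp: bij_betw_def)
    moreover have "inj_on f {z \<in> {..<v}. P (f z)}"
      using f by (auto simp: bij_betw_def intro: inj_on_subset)
    ultimately show ?thesis
      by (simp add: card_image Int_def)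
  qed
  have sym: "E a b = E b a" for a b
    unfolding E_def using arcs_symmetric by blast
  have irr: "\<not> E a a" for a
    unfolding E_def using no_loops[of "(f a, f a)"] by auto
  have row: "(\<Sum>z<v. of_bool (E a z)) = int k" if "a < v" for a
    unfolding E_def using that deg[OF f_in]
    by (subst tr[where P = "\<lambda>z. (f a, z) \<in> parcs G"]) (auto dest: in_arcsD2)
  have "(\<Sum>z<v. of_bool (E a z) * of_bool (E b z)) =
      (if a = b then int k else if E a b then int l else int \<mu>)" if ab: "a < v" "b < v" for a b
  proof (cases "a = b")
    case True
    then show ?thesis
      using row[OF ab(1)] by (simp flip: of_bool_conj)
  next
    case False
    then have "f a \<noteq> f b"
      using f ab by (auto simp: bij_betw_def inj_on_def)
    moreover have "(\<Sum>z<v. of_bool (E a z) * of_bool (E b z)) =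
        int (card {z. (f a, z) \<in> parcs G \<and> (f b, z) \<in> parcs G})"
      unfolding E_def of_bool_conj[symmetric]
      by (subst tr[where P = "\<lambda>z. (f a, z) \<in> parcs G \<and> (f b, z) \<in> parcs G"])
        (auto dest: in_arcsD2)
    ultimately show ?thesis
      using adj[OF f_in f_in, OF ab] nadj[OF f_in f_in, OF ab] False by (simp add: E_def)
  qed
  then show thesis
    using that[of E] sym irr row by blast
qed

section \<open>Matrix identities and the three block arrays\<close>

theorem theorem8:
  fixes G :: "'a pair_pre_digraph" and v k l \<mu> :: nat
  assumes "strongly_regular_graph G v k l \<mu>" and "\<mu> = l + 1"
  shows
    "(\<exists>N. STD v N \<and>
        self_dual_rectangular_design (2 * v) (v - 1)
          (int v - 2 * int k + 2 * int l) 0 (2 * (int k - int l - 1)) 2 v N) \<and>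
     (\<exists>N. STD v N \<and>
        self_dual_rectangular_design (2 * v) (v + 1)
          (int v - 2 * (int k - int l) + 2) 2 (2 * (int k - int l)) 2 v N) \<and>
     (\<exists>N. STD v N \<and>
        self_dual_rectangular_design (3 * v) v
          (int v - 2 * (int k - int l)) 0 (int k - int l) 3 v N)"
proof -
  have kv: "k + 1 < v"
    using assms(1) by (simp add: strongly_regular_graph_def)
  obtain E :: "nat \<Rightarrow> nat \<Rightarrow> bool" where sym: "\<And>a b. E a b = E b a" and irr: "\<And>a. \<not> E a a"
    and row: "\<And>a. a < v \<Longrightarrow> (\<Sum>z<v. of_bool (E a z)) = int k"
    and srg: "\<And>a b. a < v \<Longrightarrow> b < v \<Longrightarrow> (\<Sum>z<v. of_bool (E a z) * of_bool (E b z)) =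
      (if a = b then int k else if E a b then int l else int \<mu>)"
    using strongly_regular_graph_on_nat[OF assms(1)] by blast
  define A where "A a b = (of_bool (E a b) :: int)" for a b
  define D where "D a b = (of_bool (a = b) :: int)" for a b :: nat
  define F where "F a b \<longleftrightarrow> a \<noteq> b \<and> \<not> E a b" for a b
  define B where "B a b = 1 - D a b - A a b" for a b
  have Fsym: "F a b = F b a" for a b
    using sym by (auto simp: F_def)
  have Asym: "A b a = A a b" and Dsym: "D b a = D a b" for a b
    using sym by (auto simp: A_def D_def)
  \<comment> \<open>Disjunction becomes addition because \<open>E\<close> and \<open>F\<close> are
    irreflexive.\<close>
  have ob: "of_bool (E a b) = A a b" "of_bool (a = b) = D a b" "of_bool (F a b) = B a b"
    "of_bool (E a b \<or> a = b) = A a b + D a b" "of_bool (F a b \<or> a = b) = B a b + D a b" for a b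
    using irr by (auto simp: A_def D_def B_def F_def)
  have rA: "(\<Sum>z<v. A a z) = int k" and rD: "(\<Sum>z<v. D a z) = 1" if "a < v" for a
    using row[OF that] that by (simp_all add: A_def D_def of_bool_def)
  have rB: "(\<Sum>z<v. B a z) = int v - 1 - int k" if "a < v" for a
    using rA[OF that] rD[OF that] by (simp add: B_def sum_subtractf)
  have DX: "(\<Sum>z<v. D a z * X z) = X a" and XD: "(\<Sum>z<v. X z * D a z) = X a"
    if "a < v" for a and X :: "nat \<Rightarrow> int"
    using that by (simp_all add: D_def of_bool_def if_distrib if_distribR cong: if_cong)
  \<comment> \<open>The choice \<open>\<mu> = l + 1\<close> gives \<open>A a b\<close> the
    coefficient \<open>l - \<mu> = -1\<close>.\<close>
  have AA: "(\<Sum>z<v. A a z * A b z) = (int k - int l - 1) * D a b - A a b + int l + 1"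
    if "a < v" "b < v" for a b
    using srg[OF that] irr assms(2) by (auto simp: A_def D_def)
  \<comment> \<open>Expanding \<open>B b z\<close> gives the row sum \<open>k\<close>, minus
    \<open>A a b\<close>, minus the sum in \<open>AA\<close>; the coefficient -1 there makes the
    terms \<open>A a b\<close> cancel.\<close>
  have AB: "(\<Sum>z<v. A a z * B b z) = (int k - int l - 1) * (1 - D a b)"
    if ab: "a < v" "b < v" for a b
    using rA[OF ab(1)] XD[OF ab(2), of "A a"] AA[OF ab]
    by (simp add: B_def algebra_simps sum_subtractf sum.distrib)
  have BA: "(\<Sum>z<v. B a z * A b z) = (int k - int l - 1) * (1 - D a b)"
    if ab: "a < v" "b < v" for a b
    using AB[OF ab(2,1)] by (simp add: mult.commute Dsym)
  \<comment> \<open>The term \<open>+ A a b\<close> cancels against \<open>- A a b\<close> in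
    \<open>AA\<close>, so the two sums together are constant off the diagonal.\<close>
  have BB: "(\<Sum>z<v. B a z * B b z) =
      int v - 2 * int k + int l - 1 + A a b + (int k - int l) * D a b"
    if ab: "a < v" "b < v" for a b
  proof -
    have "(\<Sum>z<v. B a z * B b z) =
        (\<Sum>z<v. B b z) - (\<Sum>z<v. D a z * B b z) - (\<Sum>z<v. A a z * B b z)"
      by (simp add: B_def[of a] left_diff_distrib sum_subtractf)
    also have "\<dots> = int v - 1 - int k - B b a - (int k - int l - 1) * (1 - D a b)"
      by (simp add: rB DX AB ab)
    finally show ?thesis
      by (simp add: B_def[of b a] Asym[of a b] Dsym[of a b] algebra_simps)
  qed
  \<comment> \<open>These rules would rewrite the sums into cardinalities and similar forms before
    \<open>ob\<close> and \<open>sums\<close> apply.\<close>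
  note [simp del] = of_bool_or_iff sum_of_bool_eq sum_of_bool_mult_eq sum_mult_of_bool_eq
  note sums = rA rB rD AA AB BA BB DX XD
  have less2: "I < 2 \<longleftrightarrow> I = 0 \<or> I = 1" and less3: "I < 3 \<longleftrightarrow> I = 0 \<or> I = 1 \<or> I = 2" for I :: nat
    by auto
  have expand2: "(\<Sum>J<2. g J) = g 0 + g 1" and expand3: "(\<Sum>J<3. g J) = g 0 + g 1 + g 2"
    for g :: "nat \<Rightarrow> int"
    by (simp_all add: eval_nat_numeral)
  have Dneq: "D a b = 0" if "a \<noteq> b" for a b
    using that by (simp add: D_def)
  have Deq: "D a a = 1" for a
    by (simp add: D_def)
  have "\<exists>N. STD v N \<and> self_dual_rectangular_design (2 * v) (v - 1)
      (int v - 2 * int k + 2 * int l) 0 (2 * (int k - int l - 1)) 2 v N"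
  proof (rule symmetric_block_design[where M = "\<lambda>I J. if I = J then E else F"
        and R = "\<lambda>I J. if I = J then int k else int v - 1 - int k"], goal_cases)
    \<comment> \<open>Equal block rows give \<open>AA\<close> plus \<open>BB\<close>; different ones
      give \<open>AB\<close> plus \<open>BA\<close>, which vanishes on the diagonal.\<close>
    case (5 I I' a b)
    then show ?case
      unfolding less2 expand2
      by (auto simp: ob sums Deq Dneq)
  next
    case (2 I J a b)
    then show ?case
      using sym Fsym by (auto simp: add.commute)
  next
    case (3 I J a)
    then show ?case
      by (auto simp: ob sums sum.distrib)
  next
    case (4 I)
    then show ?case
      unfolding less2 expand2 using kv by auto
  qed (use kv in simp)
  moreover have "\<exists>N. STD v N \<and> self_dual_rectangular_design (2 * v) (v + 1)
      (int v - 2 * (int k - int l) + 2) 2 (2 * (int k - int l)) 2 v N"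
  proof (rule symmetric_block_design[where
        M = "\<lambda>I J a b. (if I = J then E a b else F a b) \<or> a = b"
        and R = "\<lambda>I J. if I = J then int k + 1 else int v - int k"], goal_cases)
    \<comment> \<open>Adding \<open>D\<close> to both blocks contributes
      \<open>2 * (A a b + B a b) + 2 * D a b\<close> in either case. Since \<open>A + B + D\<close>
      is constantly 1, this is 2 everywhere, which raises each concurrence parameter of the first
      design by 2.\<close>
    case (5 I I' a b)
    then show ?case
      unfolding less2 expand2
      by (auto simp: ob sums Deq Dneq distrib_left distrib_right sum.distrib)
         (auto simp: B_def Asym Deq Dneq algebra_simps)
  next
    case (2 I J a b)
    then show ?case
      using sym Fsym by (auto simp: add.commute)
  next
    case (3 I J a)
    then show ?case
      by (auto simp: ob sums sum.distrib)
  next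
    case (4 I)
    then show ?case
      unfolding less2 expand2 using kv by auto
  qed (use kv in simp)
  moreover have "\<exists>N. STD v N \<and> self_dual_rectangular_design (3 * v) v
      (int v - 2 * (int k - int l)) 0 (int k - int l) 3 v N"
  \<comment> \<open>Indexing by \<open>I + J\<close> rather than \<open>I - J\<close> keeps the
    cyclic array symmetric; the equality relation supplies the identity block.\<close>
  proof (rule symmetric_block_design[where
        M = "\<lambda>I J. if (I + J) mod 3 = 0 then E else if (I + J) mod 3 = 1 then F else (=)"
        and R = "\<lambda>I J. if (I + J) mod 3 = 0 then int k
          else if (I + J) mod 3 = 1 then int v - 1 - int k else 1"], goal_cases)
    \<comment> \<open>Any two different block rows pair \<open>A\<close> with \<open>B\<close>,
      \<open>B\<close> with \<open>D\<close> and \<open>D\<close> with \<open>A\<close>, up to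
      order. The sum is \<open>(k - l - 1) * (1 - D)\<close> plus
      \<open>A + B = 1 - D\<close>.\<close>
    case (5 I I' a b)
    from 5(1,2) show ?case
      unfolding less3 expand3
      by (elim disjE; use 5(3-5) in
          \<open>simp add: ob sums Deq Dneq del: One_nat_def split del: if_split\<close>)
         (use 5(3-5) in \<open>auto simp: B_def Asym Deq Dneq algebra_simps\<close>)
  next
    case (2 I J a b)
    then show ?case
      using sym Fsym by (auto simp: add.commute)
  next
    case (3 I J a)
    then show ?case
      by (auto simp: ob sums sum.distrib)
  next
    case (4 I)
    then show ?case
      unfolding less3 expand3 by (elim disjE) (simp_all del: One_nat_def)
  qed (use kv in simp)
  ultimately show ?thesis
    by blast
qed

end
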